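(* Let $a\in(1/15,\infty)$ and let $F_a(x)=\psi(x+1)-\mathcal{L}(x,a)$ for $x\in(0,\infty)$. Then $F_a$ is decreasing on $(0,\infty)$ if and only if $a\in(1/15,a_0']$, where $$a_0'=\frac{45-4\pi^2+3\sqrt{4\pi^4-80\pi^2+405}}{30(\pi^2-9)}\approx 0.47053.$$
   Context: $\psi(x)=\Gamma'(x)/\Gamma(x)$ ($x>0$) is the digamma (psi) function. For $x>0$ and $a>1/15$, $$\mathcal{L}(x,a)=\frac{1}{90a^{2}+2}\ln\left(x^{2}+x+\frac{3a+1}{3}\right)+\frac{45a^{2}}{90a^{2}+2}\ln\left(x^{2}+x+\frac{15a-1}{45a}\right).$$ *)

theory Defs
  imports "HOL-Analysis.Analysis"
begin

definition L_approx :: "real \<Rightarrow> real \<Rightarrow> real" where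
  "L_approx x a =
     1 / (90 * a\<^sup>2 + 2) * ln (x\<^sup>2 + x + (3 * a + 1) / 3)
     + 45 * a\<^sup>2 / (90 * a\<^sup>2 + 2) * ln (x\<^sup>2 + x + (15 * a - 1) / (45 * a))"

(* On the positive reals, the library's Digamma is the logarithmic derivative of Gamma:
   see has_field_derivative_Gamma, which gives the derivative Gamma x * Digamma x. *)
definition F :: "real \<Rightarrow> real \<Rightarrow> real" where
  "F a x = Digamma (x + 1) - L_approx x a"

definition a0' :: real where
  "a0' = (45 - 4 * pi\<^sup>2 + 3 * sqrt (4 * pi ^ 4 - 80 * pi\<^sup>2 + 405)) / (30 * (pi\<^sup>2 - 9))"

end

theory Submission
  imports Defs "HOL-Real_Asymp.Real_Asymp"
begin

text \<open>
  The two arguments of the logarithms enter the derivative of \<open>L_approx\<close> only through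
  \<open>s = a - 1/(45 a)\<close>: with \<open>t = x + 1/2\<close> and \<open>v = t\<^sup>2 + 1/12 = x\<^sup>2 + x + 1/3\<close> the
  derivative in \<open>x\<close> is
  \<open>trigamma_approx s x = t (v + s) / (v (v + s) - 1/45)\<close>,
  a rational function that matches the asymptotic expansion of the trigamma function
  \<open>\<psi>'(t + 1/2)\<close> up to and including the term in \<open>t\<^sup>-\<^sup>5\<close>, for every \<open>s\<close>.
  Monotonicity of \<open>F a\<close> is therefore the question for which \<open>s\<close> the bound
  \<open>\<psi>'(x + 1) \<le> trigamma_approx s x\<close> holds for all \<open>x > 0\<close>. Since
  \<open>trigamma_approx s x\<close> decreases in \<open>s\<close>, these \<open>s\<close> form an interval. The worst
  point turns out to be \<open>x = 0\<close>, where \<open>\<psi>'(1) = pi\<^sup>2/6\<close>; solving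
  \<open>trigamma_approx s 0 = pi\<^sup>2/6\<close> gives the critical value
  \<open>s_crit = (45 - 4 pi\<^sup>2) / (15 (pi\<^sup>2 - 9))\<close>, and \<open>a0'\<close> is the positive root
  of \<open>a - 1/(45 a) = s_crit\<close>. Necessity of \<open>s \<le> s_crit\<close> is the limit \<open>x \<rightarrow> 0\<close>.

  Sufficiency is the inequality \<open>\<psi>'(x + 1) \<le> trigamma_approx s_crit x\<close> for \<open>x \<ge> 0\<close>
  (\<open>trigamma_le_approx_crit\<close>), with equality at \<open>0\<close>. Away from \<open>0\<close> it follows by
  telescoping: \<open>\<psi>'(x + 1)\<close> is the sum of \<open>1/(x + 1 + k)\<^sup>2\<close>, and
  \<open>trigamma_approx s x - trigamma_approx s (x + 1) - 1/(x + 1)\<^sup>2\<close> is a positive multiple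
  of the quadratic \<open>(16 - 21 s) (x + 1)\<^sup>2 - 15 (s + 4/15)\<^sup>2\<close> (\<open>approx_diff\<close>). For
  \<open>s = s_crit\<close> this is nonnegative once \<open>x \<ge> 1/50\<close>. At \<open>x = 0\<close> it has to be
  negative, since otherwise telescoping would give a strict inequality there. So on the
  short interval \<open>[0, 1/50]\<close> another argument is used:
  \<open>trigamma_approx s_crit x - \<psi>'(x + 1)\<close> starts at \<open>0\<close> and has a nonnegative
  derivative, which becomes a polynomial inequality once \<open>\<psi>''(x + 1)\<close> is bounded by
  rational functions.

  The only numerical information about \<open>pi\<close> is a rough enclosure of \<open>s_crit\<close>. It comes
  from the same telescoping bounds, because \<open>pi\<^sup>2/6 = 1 + \<psi>'(2)\<close>.
\<close>

section \<open>Bounding trigamma and tetragamma sums by telescoping\<close>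

lemma le_of_sums_le_telescope:
  fixes f g :: "nat \<Rightarrow> real"
  assumes "f sums S" and "\<And>k. f k \<le> g k - g (Suc k)" and "g \<longlonglongrightarrow> 0"
  shows "S \<le> g 0"
  using sums_le[OF assms(2) assms(1) telescope_sums'[OF assms(3)]] by simp

lemma ge_of_sums_ge_telescope:
  fixes f g :: "nat \<Rightarrow> real"
  assumes "f sums S" and "\<And>k. g k - g (Suc k) \<le> f k" and "g \<longlonglongrightarrow> 0"
  shows "g 0 \<le> S"
  using sums_le[OF assms(2) telescope_sums'[OF assms(3)] assms(1)] by simp

lemma trigamma_sums:
  fixes z :: real
  assumes "z > 0"
  shows "(\<lambda>k. 1 / (z + real k)\<^sup>2) sums Polygamma 1 z"
  using Polygamma_LIMSEQ[of z 1] assms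
  by (simp add: power2_eq_square field_simps)

lemma tetragamma_sums:
  fixes z :: real
  assumes "z > 0"
  shows "(\<lambda>k. 1 / (z + real k) ^ 3) sums (- Polygamma 2 z / 2)"
  using Polygamma_LIMSEQ[of z 2] assms
  by (simp add: power3_eq_cube field_simps)

lemma trigamma_one: "Polygamma 1 (1::real) = pi\<^sup>2 / 6"
proof -
  have "(\<lambda>k. 1 / (1 + real k)\<^sup>2) sums (pi\<^sup>2 / 6)"
    using inverse_squares_sums by (simp add: add_ac)
  then show ?thesis
    using sums_unique2 trigamma_sums[of 1] by force
qed

text \<open>
  Here \<open>- \<psi>''(z)\<close> is the sum of \<open>2/(z + k)\<^sup>3\<close>, and \<open>1/z\<^sup>2\<close> is the integral of
  \<open>2/u\<^sup>3\<close> over \<open>u \<ge> z\<close>. The trapezoidal rule overestimates the integral of a convex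
  function, so the sum exceeds the integral by at least half of its first term.
\<close>

lemma tetragamma_le:
  fixes z :: real
  assumes z: "z > 0"
  shows "Polygamma 2 z \<le> - (1 / z\<^sup>2 + 1 / z ^ 3)"
proof -
  define g where "g y = (1 / y\<^sup>2 + 1 / y ^ 3) / 2" for y :: real
  have step: "g y - g (y + 1) \<le> 1 / y ^ 3" if y: "y > 0" for y
  proof -
    define u w where "u = 1 / y" and "w = 1 / (y + 1)"
    have "u - w = u * w" using y by (simp add: u_def w_def field_simps)
    then have "u ^ 3 - ((u\<^sup>2 + u ^ 3) / 2 - (w\<^sup>2 + w ^ 3) / 2) = (u * w)\<^sup>2 * (u + w) / 2"
      by (simp add: field_simps) algebra
    moreover have "u \<ge> 0" "w \<ge> 0" using y by (simp_all add: u_def w_def)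
    ultimately have "(u\<^sup>2 + u ^ 3) / 2 - (w\<^sup>2 + w ^ 3) / 2 \<le> u ^ 3"
      by (smt (verit) zero_le_power2 mult_nonneg_nonneg divide_nonneg_pos)
    then show ?thesis by (simp add: g_def u_def w_def power_divide)
  qed
  have "(\<lambda>k. g (z + real k)) \<longlonglongrightarrow> 0"
    unfolding g_def by real_asymp
  moreover have "g (z + real k) - g (z + real (Suc k)) \<le> 1 / (z + real k) ^ 3" for k
    using step[of "z + real k"] z by (simp add: add_ac)
  ultimately have "g (z + real 0) \<le> - Polygamma 2 z / 2"
    by (intro ge_of_sums_ge_telescope[OF tetragamma_sums[OF z]])
  then show ?thesis by (simp add: g_def)
qed

section \<open>The rational approximation of the trigamma function\<close>

definition trigamma_approx :: "real \<Rightarrow> real \<Rightarrow> real" where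
  "trigamma_approx s x =
     (x + 1/2) * (x\<^sup>2 + x + 1/3 + s) / ((x\<^sup>2 + x + 1/3) * (x\<^sup>2 + x + 1/3 + s) - 1/45)"

text \<open>
  The bound \<open>- 4/15\<close> is sharp: it is the \<open>s\<close> for which the denominator vanishes at \<open>x = 0\<close>.
  It is also the value of \<open>a - 1/(45 a)\<close> at \<open>a = 1/15\<close>.
\<close>

lemma approx_denom_pos:
  fixes s x :: real
  assumes "s > - 4/15" "x \<ge> 0"
  shows "(x\<^sup>2 + x + 1/3) * (x\<^sup>2 + x + 1/3 + s) - 1/45 > 0"
proof -
  have "(1/3) * (1/15) < (x\<^sup>2 + x + 1/3) * (x\<^sup>2 + x + 1/3 + s)"
    using assms zero_le_power2[of x] by (intro mult_le_less_imp_less) linarith+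
  then show ?thesis by simp
qed

lemma approx_tendsto_0: "(trigamma_approx s \<longlongrightarrow> 0) at_top"
  unfolding trigamma_approx_def by real_asymp

text \<open>
  Over the common denominator, of degree 10 in \<open>m = x + 1\<close>, the numerator is a combination of
  products of degree 8 and 9. It collapses to degree 2: the approximation agrees with the trigamma
  function up to \<open>t\<^sup>-\<^sup>5\<close>, so the left-hand side is of order \<open>m\<^sup>-\<^sup>8\<close>. It has no linear
  term because \<open>v\<close> takes the values \<open>m\<^sup>2 - m + 1/3\<close> and \<open>m\<^sup>2 + m + 1/3\<close> at \<open>x\<close> and
  \<open>x + 1\<close>, which are exchanged by the reflection of \<open>m\<close>.
\<close>

lemma approx_diff:
  assumes "s > - 4/15" "x \<ge> 0"
  shows "\<exists>c>0. trigamma_approx s x - trigamma_approx s (x + 1) - 1 / (x + 1)\<^sup>2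
    = c * ((16 - 21 * s) * (x + 1)\<^sup>2 - 15 * (s + 4/15)\<^sup>2)"
proof -
  define m where "m = x + 1"
  define v w where "v = m\<^sup>2 - m + 1/3" and "w = m\<^sup>2 + m + 1/3"
  define D E where "D = v * (v + s) - 1/45" and "E = w * (w + s) - 1/45"
  have v: "x\<^sup>2 + x + 1/3 = v" and w: "(x + 1)\<^sup>2 + (x + 1) + 1/3 = w"
    by (simp_all add: v_def w_def m_def power2_eq_square algebra_simps)
  have pos: "D > 0" "E > 0" "m > 0"
    using approx_denom_pos[OF assms] approx_denom_pos[of s "x + 1"] assms
    unfolding v w D_def E_def m_def by simp_all
  have approx: "trigamma_approx s x = (m - 1/2) * (v + s) / D"
    "trigamma_approx s (x + 1) = (m + 1/2) * (w + s) / E"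
    unfolding trigamma_approx_def v w D_def E_def by (simp_all add: m_def)
  have "trigamma_approx s x - trigamma_approx s (x + 1) - 1 / m\<^sup>2 =
     (((m - 1/2) * (v + s) * E - (m + 1/2) * (w + s) * D) * m\<^sup>2 - D * E) / (D * E * m\<^sup>2)"
    using pos unfolding approx by (simp add: diff_frac_eq mult_ac)
  also have "((m - 1/2) * (v + s) * E - (m + 1/2) * (w + s) * D) * m\<^sup>2 - D * E
     = ((16 - 21 * s) * m\<^sup>2 - 15 * (s + 4/15)\<^sup>2) / 135"
    unfolding D_def E_def v_def w_def by (simp add: algebra_simps power2_eq_square)
  finally have "trigamma_approx s x - trigamma_approx s (x + 1) - 1 / (x + 1)\<^sup>2
    = 1 / (135 * (D * E * m\<^sup>2)) * ((16 - 21 * s) * (x + 1)\<^sup>2 - 15 * (s + 4/15)\<^sup>2)"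
    by (simp add: m_def)
  moreover have "1 / (135 * (D * E * m\<^sup>2)) > 0"
    using pos by simp
  ultimately show ?thesis by blast
qed

text \<open>
  The quadratic in \<open>approx_diff\<close> grows with \<open>x\<close> when \<open>s \<le> 16/21\<close>, so its sign at the first
  term decides all later ones. For \<open>s \<ge> 16/21\<close> it is nonpositive everywhere; \<open>16/21\<close> is the
  value for which the expansions of both sides also agree in the term \<open>t\<^sup>-\<^sup>7\<close>.
\<close>

lemma trigamma_le_approx:
  assumes s: "s > - 4/15" "s \<le> 16/21" and x: "x \<ge> 0"
    and "15 * (s + 4/15)\<^sup>2 \<le> (16 - 21 * s) * (x + 1)\<^sup>2"
  shows "Polygamma 1 (x + 1) \<le> trigamma_approx s x"
proof -
  have step: "1 / (y + 1)\<^sup>2 \<le> trigamma_approx s y - trigamma_approx s (y + 1)" if y: "y \<ge> x" for y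
  proof -
    obtain c where c: "c > 0" "trigamma_approx s y - trigamma_approx s (y + 1) - 1 / (y + 1)\<^sup>2
      = c * ((16 - 21 * s) * (y + 1)\<^sup>2 - 15 * (s + 4/15)\<^sup>2)"
      using approx_diff[OF s(1), of y] y x by auto
    have "(16 - 21 * s) * (x + 1)\<^sup>2 \<le> (16 - 21 * s) * (y + 1)\<^sup>2"
      using s x y by (intro mult_left_mono power_mono) auto
    with assms(4) c(1) have "0 \<le> c * ((16 - 21 * s) * (y + 1)\<^sup>2 - 15 * (s + 4/15)\<^sup>2)" by simp
    with c(2) show ?thesis by simp
  qed
  have lim: "(\<lambda>k. trigamma_approx s (x + real k)) \<longlonglongrightarrow> 0"
    by (rule filterlim_compose[OF approx_tendsto_0]) real_asymp
  show ?thesis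
    using le_of_sums_le_telescope[OF trigamma_sums[of "x + 1"] _ lim] step[of "x + real k" for k] x
    by (simp add: add_ac)
qed

lemma approx_le_trigamma:
  assumes s: "s \<ge> 16/21" and x: "x \<ge> 0"
  shows "trigamma_approx s x \<le> Polygamma 1 (x + 1)"
proof -
  have s': "s > - 4/15" using s by simp
  have step: "trigamma_approx s y - trigamma_approx s (y + 1) \<le> 1 / (y + 1)\<^sup>2" if y: "y \<ge> x" for y
  proof -
    obtain c where c: "c > 0" "trigamma_approx s y - trigamma_approx s (y + 1) - 1 / (y + 1)\<^sup>2
      = c * ((16 - 21 * s) * (y + 1)\<^sup>2 - 15 * (s + 4/15)\<^sup>2)"
      using approx_diff[OF s', of y] y x by auto
    have "(16 - 21 * s) * (y + 1)\<^sup>2 \<le> 0"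
      using s by (intro mult_nonpos_nonneg) auto
    moreover have "15 * (s + 4/15)\<^sup>2 \<ge> 0" by simp
    ultimately have "c * ((16 - 21 * s) * (y + 1)\<^sup>2 - 15 * (s + 4/15)\<^sup>2) \<le> 0"
      using c(1) by (intro mult_nonneg_nonpos) linarith+
    with c(2) show ?thesis by simp
  qed
  have lim: "(\<lambda>k. trigamma_approx s (x + real k)) \<longlonglongrightarrow> 0"
    by (rule filterlim_compose[OF approx_tendsto_0]) real_asymp
  show ?thesis
    using ge_of_sums_ge_telescope[OF trigamma_sums[of "x + 1"] _ lim] step[of "x + real k" for k] x
    by (simp add: add_ac)
qed

lemma approx_le_iff:
  assumes "s > - 4/15" "s' > - 4/15" "x \<ge> 0"
  shows "trigamma_approx s x \<le> trigamma_approx s' x \<longleftrightarrow> s' \<le> s"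
proof -
  define v where "v = x\<^sup>2 + x + 1/3"
  define D where "D s = v * (v + s) - 1/45" for s
  have D: "D s > 0" "D s' > 0"
    using approx_denom_pos[of s x] approx_denom_pos[of s' x] assms by (simp_all add: D_def v_def)
  have "trigamma_approx s' x - trigamma_approx s x
      = ((x + 1/2) * (v + s') * D s - (x + 1/2) * (v + s) * D s') / (D s * D s')"
    using D unfolding trigamma_approx_def v_def[symmetric] D_def[symmetric] by (simp add: diff_frac_eq mult_ac)
  also have "(x + 1/2) * (v + s') * D s - (x + 1/2) * (v + s) * D s' = (x + 1/2) / 45 * (s - s')"
    unfolding D_def by (simp add: field_simps)
  finally have "trigamma_approx s' x - trigamma_approx s x
      = (x + 1/2) / 45 / (D s * D s') * (s - s')" by simp
  moreover have "(x + 1/2) / 45 / (D s * D s') > 0" using D assms(3) by simp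
  ultimately show ?thesis
    by (metis diff_ge_0_iff_ge zero_le_mult_iff less_le_not_le)
qed

section \<open>The critical parameter\<close>

text \<open>The solution of \<open>trigamma_approx s 0 = pi\<^sup>2/6\<close>, see \<open>approx_crit_0\<close>.\<close>

definition s_crit :: real where "s_crit = (45 - 4 * pi\<^sup>2) / (15 * (pi\<^sup>2 - 9))"

text \<open>
  The recurrence moves the evaluation point from \<open>1\<close> to \<open>2\<close>, where the approximations with
  parameters \<open>17/40\<close> and \<open>16/21\<close>, an upper and a lower bound, are close together.
\<close>

lemma pi_squared_bounds: "9.868 \<le> pi\<^sup>2" "pi\<^sup>2 \<le> 9.873"
proof -
  have *: "pi\<^sup>2 / 6 = 1 + Polygamma 1 (1 + 1::real)"
    using Polygamma_plus1[of "1::real" 1] trigamma_one by simp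
  have "Polygamma 1 (1 + 1::real) \<le> trigamma_approx (17/40) 1"
    by (rule trigamma_le_approx) (simp_all add: power2_eq_square)
  then show "pi\<^sup>2 \<le> 9.873" using * by (simp add: trigamma_approx_def)
  have "trigamma_approx (16/21) 1 \<le> Polygamma 1 (1 + 1::real)"
    by (rule approx_le_trigamma) simp_all
  then show "9.868 \<le> pi\<^sup>2" using * by (simp add: trigamma_approx_def)
qed

lemma s_crit_bounds: "21/50 \<le> s_crit" "s_crit \<le> 17/40"
  using pi_squared_bounds by (simp_all add: s_crit_def field_simps)

lemma approx_crit_0: "trigamma_approx s_crit 0 = pi\<^sup>2 / 6"
proof -
  have "pi\<^sup>2 > 9" using pi_squared_bounds by simp
  then show ?thesis
    unfolding trigamma_approx_def s_crit_def by (simp add: divide_simps)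
qed

section \<open>The trigamma bound with the critical parameter\<close>

lemma approx_has_derivative:
  fixes s x :: real
  assumes "s > - 4/15" "x \<ge> 0"
  defines "t \<equiv> x + 1/2" and "v \<equiv> x\<^sup>2 + x + 1/3"
  shows "(trigamma_approx s has_real_derivative
    ((v + s + 2 * t\<^sup>2) * (v * (v + s) - 1/45) - 2 * t\<^sup>2 * (v + s) * (2 * v + s))
      / (v * (v + s) - 1/45)\<^sup>2) (at x)"
proof -
  have "v * (v + s) - 1/45 \<noteq> 0"
    using approx_denom_pos[OF assms(1,2)] unfolding v_def by simp
  then show ?thesis
    unfolding trigamma_approx_def t_def v_def
    by (auto intro!: derivative_eq_intros simp: power2_eq_square)
       (simp add: algebra_simps)
qed

text \<open>
  Divided by \<open>D\<^sup>2\<close>, this bounds minus the derivative of \<open>trigamma_approx s\<close> by a linear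
  function, namely the tangent at \<open>0\<close> of the bound for \<open>- \<psi>''(x + 1)\<close> in
  \<open>tetragamma_le_near_zero\<close>. Expanding in \<open>e = s - 21/50\<close>, each coefficient is a polynomial in
  \<open>x\<close> whose only positive term is the constant one, and on \<open>[0, 1/50]\<close> that term dominates.
\<close>

lemma near_zero_polynomial:
  fixes s x :: real
  assumes s: "21/50 \<le> s" and x: "0 \<le> x" "x \<le> 1/50"
  defines "t \<equiv> x + 1/2" and "v \<equiv> x\<^sup>2 + x + 1/3"
  defines "D \<equiv> v * (v + s) - 1/45"
  shows "2 * t\<^sup>2 * (v + s) * (2 * v + s) - (v + s + 2 * t\<^sup>2) * D \<le> (19/8 - 103/16 * x) * D\<^sup>2"
proof -
  define e where "e = s - 21/50"
  have p: "x ^ k \<le> (1/50) ^ k" for k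
    using x by (intro power_mono) auto
  note p = p[of 2] p[of 3] p[of 4] p[of 5] p[of 6] p[of 7] p[of 8] p[of 9]
  define c0 where "c0 = 3223/1620000 - 133171/3240000 * x - 23213/33750 * x ^ 2
      - 5564723/1080000 * x ^ 3 - 180097/10000 * x ^ 4 - 13310507/360000 * x ^ 5
      - 59173/1200 * x ^ 6 - 51739/1200 * x ^ 7 - 187/8 * x ^ 8 - 103/16 * x ^ 9"
  define c1 where "c1 = 481/5400 - 157/10800 * x - 427/225 * x ^ 2 - 41951/3600 * x ^ 3
      - 6089/200 * x ^ 4 - 17063/400 * x ^ 5 - 271/8 * x ^ 6 - 103/8 * x ^ 7"
  define c2 where "c2 = 7/72 - 19/144 * x - 4/3 * x ^ 2 - 287/48 * x ^ 3 - 21/2 * x ^ 4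
      - 103/16 * x ^ 5"
  have "c0 \<ge> 0" "c1 \<ge> 0" "c2 \<ge> 0"
    using p x(2) unfolding c0_def c1_def c2_def by (simp_all add: power_divide)
  moreover have "e \<ge> 0" using s by (simp add: e_def)
  ultimately have "0 \<le> c0 + c1 * e + c2 * e\<^sup>2" by simp
  also have "\<dots> = (19/8 - 103/16 * x) * D\<^sup>2
      - (2 * t\<^sup>2 * (v + s) * (2 * v + s) - (v + s + 2 * t\<^sup>2) * D)"
    unfolding c0_def c1_def c2_def e_def D_def t_def v_def
    by (simp add: field_simps power2_eq_square eval_nat_numeral)
  finally show ?thesis by simp
qed

text \<open>
  The leading term \<open>2/(x + 1)\<^sup>3\<close> of \<open>- \<psi>''(x + 1)\<close> is split off before
  \<open>tetragamma_le\<close> is applied: at \<open>x + 1\<close> itself that bound would be too weak to compensate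
  the derivative of \<open>trigamma_approx s_crit\<close>. Convexity then allows each summand to be
  replaced by its tangent at \<open>0\<close>.
\<close>

lemma tetragamma_le_near_zero:
  fixes x :: real
  assumes x: "x \<ge> 0"
  shows "Polygamma 2 (x + 1) \<le> - (19/8 - 103/16 * x)"
proof -
  have "Polygamma 2 (x + 1 + 1) = Polygamma 2 (x + 1) + 2 / (x + 1) ^ 3"
    using Polygamma_plus1[of "x + 1" 2] x by (simp add: eval_nat_numeral)
  moreover have "Polygamma 2 (x + 1 + 1) \<le> - (1 / (x + 2)\<^sup>2 + 1 / (x + 2) ^ 3)"
    using tetragamma_le[of "x + 1 + 1"] x by (simp add: add.assoc)
  moreover have "1 - 3 * x \<le> 1 / (x + 1) ^ 3"
  proof -
    have "(1 - 3 * x) * (x + 1) ^ 3 = 1 - x\<^sup>2 * (6 + 8 * x + 3 * x\<^sup>2)"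
      by (simp add: algebra_simps power2_eq_square power3_eq_cube)
    also have "\<dots> \<le> 1" using x by simp
    finally show ?thesis using x by (simp add: field_simps)
  qed
  moreover have "1/4 - x/4 \<le> 1 / (x + 2)\<^sup>2"
  proof -
    have "(1/4 - x/4) * (x + 2)\<^sup>2 = 1 - x\<^sup>2 * (3 + x) / 4"
      by (simp add: field_simps power2_eq_square)
    also have "\<dots> \<le> 1" using x by simp
    finally show ?thesis using x by (simp add: field_simps)
  qed
  moreover have "1/8 - 3/16 * x \<le> 1 / (x + 2) ^ 3"
  proof -
    have "(1/8 - 3/16 * x) * (x + 2) ^ 3 = 1 - x\<^sup>2 * (24 + 16 * x + 3 * x\<^sup>2) / 16"
      by (simp add: field_simps power2_eq_square power3_eq_cube)
    also have "\<dots> \<le> 1" using x by simp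
    finally show ?thesis using x by (simp add: field_simps)
  qed
  ultimately show ?thesis by linarith
qed

lemma trigamma_le_approx_crit:
  assumes x: "x \<ge> 0"
  shows "Polygamma 1 (x + 1) \<le> trigamma_approx s_crit x"
proof (cases "x \<le> 1/50")
  case True
  define G where "G y = trigamma_approx s_crit y - Polygamma 1 (y + 1)" for y :: real
  have "G 0 \<le> G x"
  proof (rule DERIV_nonneg_imp_nondecreasing[OF x])
    fix y :: real assume y: "0 \<le> y" "y \<le> x"
    define t v where "t = y + 1/2" and "v = y\<^sup>2 + y + 1/3"
    define D where "D = v * (v + s_crit) - 1/45"
    define approx' where "approx' = ((v + s_crit + 2 * t\<^sup>2) * D - 2 * t\<^sup>2 * (v + s_crit) * (2 * v + s_crit)) / D\<^sup>2"
    have D: "D > 0"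
      using approx_denom_pos[of s_crit y] s_crit_bounds y by (simp add: D_def v_def)
    have "(trigamma_approx s_crit has_real_derivative approx') (at y)"
      using approx_has_derivative[of s_crit y] s_crit_bounds y unfolding approx'_def D_def t_def v_def by simp
    moreover have "y + 1 \<notin> \<int>\<^sub>\<le>\<^sub>0" using y by (auto elim!: nonpos_Ints_cases)
    ultimately have "(G has_real_derivative approx' - Polygamma 2 (y + 1)) (at y)"
      unfolding G_def by (auto intro!: derivative_eq_intros simp: numeral_2_eq_2)
    moreover have "approx' - Polygamma 2 (y + 1) \<ge> 0"
    proof -
      have "- approx' \<le> 19/8 - 103/16 * y"
        using near_zero_polynomial[OF s_crit_bounds(1) y(1)] y(2) True D
        unfolding approx'_def D_def t_def v_def by (simp add: divide_simps mult_ac)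
      then show ?thesis using tetragamma_le_near_zero[OF y(1)] by simp
    qed
    ultimately show "\<exists>d. (G has_real_derivative d) (at y) \<and> 0 \<le> d" by blast
  qed
  then show ?thesis using trigamma_one by (simp add: G_def approx_crit_0)
next
  case False
  (* The left-hand side grows and the right-hand side shrinks with the parameter, so it suffices
     to check the upper bound 17/40 of s_crit, at the smallest x. *)
  have "15 * (s_crit + 4/15)\<^sup>2 \<le> 15 * (17/40 + 4/15)\<^sup>2"
    using s_crit_bounds by (intro mult_left_mono power_mono) auto
  also have "\<dots> \<le> (16 - 21 * (17/40)) * (1/50 + 1)\<^sup>2"
    by (simp add: power2_eq_square)
  also have "\<dots> \<le> (16 - 21 * s_crit) * (x + 1)\<^sup>2"
    using s_crit_bounds False by (intro mult_mono power_mono) auto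
  finally show ?thesis
    using trigamma_le_approx[of s_crit x] s_crit_bounds x by simp
qed

text \<open>
  Letting \<open>x\<close> tend to \<open>0\<close> gives necessity; sufficiency follows from the critical case because
  the approximation decreases in \<open>s\<close>.
\<close>

lemma trigamma_le_approx_iff:
  assumes s: "s > - 4/15"
  shows "(\<forall>x>0. Polygamma 1 (x + 1) \<le> trigamma_approx s x) \<longleftrightarrow> s \<le> s_crit"
proof
  assume *: "\<forall>x>0. Polygamma 1 (x + 1) \<le> trigamma_approx s x"
  have "isCont (\<lambda>x. trigamma_approx s x - Polygamma 1 (x + 1)) 0"
    using DERIV_isCont[OF approx_has_derivative[OF s, of 0]]
    by (intro continuous_intros) (auto elim!: nonpos_Ints_cases)
  then have "((\<lambda>x. trigamma_approx s x - Polygamma 1 (x + 1)) \<longlongrightarrow> trigamma_approx s 0 - Polygamma 1 1)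
      (at_right 0)"
    by (auto simp: isCont_def filterlim_at_split)
  moreover have "\<forall>\<^sub>F x in at_right 0. 0 \<le> trigamma_approx s x - Polygamma 1 (x + 1)"
    using * by (auto simp: eventually_at_right_less intro!: eventually_at_rightI[of 0 1])
  ultimately have "0 \<le> trigamma_approx s 0 - Polygamma 1 1"
    by (rule tendsto_lowerbound) simp
  then have "trigamma_approx s_crit 0 \<le> trigamma_approx s 0" using trigamma_one by (simp add: approx_crit_0)
  then show "s \<le> s_crit" using approx_le_iff[of s_crit s 0] s s_crit_bounds by simp
next
  assume le: "s \<le> s_crit"
  show "\<forall>x>0. Polygamma 1 (x + 1) \<le> trigamma_approx s x"
  proof (intro allI impI)
    fix x :: real assume "x > 0"
    then show "Polygamma 1 (x + 1) \<le> trigamma_approx s x"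
      using trigamma_le_approx_crit[of x] approx_le_iff[of s_crit s x] s s_crit_bounds le by simp
  qed
qed

section \<open>The derivative of F and the parameter a\<close>

text \<open>
  The arguments of the logarithms are \<open>v + a\<close> and \<open>v - 1/(45 a)\<close>, whose product is
  \<open>v (v + s) - 1/45\<close>; the weights are those for which the numerator depends on \<open>a\<close> only
  through \<open>s\<close> as well.
\<close>

lemma L_approx_has_derivative:
  assumes a: "a > 1/15" and x: "x > 0"
  shows "((\<lambda>x. L_approx x a) has_real_derivative trigamma_approx (a - 1 / (45 * a)) x) (at x)"
proof -
  define s where "s = a - 1 / (45 * a)"
  define v where "v = x\<^sup>2 + x + 1/3"
  have v: "v > 1/3" using x by (simp add: v_def add_pos_pos)
  have "1 / (45 * a) < 1/3" using a by (simp add: field_simps)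
  then have pos: "v + a > 0" "v - 1 / (45 * a) > 0" using v a by linarith+
  have arg: "x\<^sup>2 + x + (3 * a + 1) / 3 = v + a" "x\<^sup>2 + x + (15 * a - 1) / (45 * a) = v - 1 / (45 * a)"
    using a by (simp_all add: v_def field_simps)
  have "90 * a\<^sup>2 + 2 > 0" by (simp add: add_nonneg_pos)
  then have weight: "90 * a\<^sup>2 + 2 \<noteq> 0" by simp
  have "((\<lambda>x. L_approx x a) has_real_derivative
      1 / (90 * a\<^sup>2 + 2) * ((2 * x + 1) / (v + a))
      + 45 * a\<^sup>2 / (90 * a\<^sup>2 + 2) * ((2 * x + 1) / (v - 1 / (45 * a)))) (at x)"
    unfolding L_approx_def using pos weight unfolding arg[symmetric]
    by (auto intro!: derivative_eq_intros simp: mult_ac)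
  also have "1 / (90 * a\<^sup>2 + 2) * ((2 * x + 1) / (v + a))
      + 45 * a\<^sup>2 / (90 * a\<^sup>2 + 2) * ((2 * x + 1) / (v - 1 / (45 * a)))
      = (x + 1/2) * ((v - 1 / (45 * a) + 45 * a\<^sup>2 * (v + a)) / (45 * a\<^sup>2 + 1))
         / ((v + a) * (v - 1 / (45 * a)))"
  proof -
    define A B W h where "A = v + a" and "B = v - 1 / (45 * a)" and "W = 45 * a\<^sup>2 + 1"
      and "h = x + 1/2"
    have h: "90 * a\<^sup>2 + 2 = 2 * W" "2 * x + 1 = 2 * h" by (simp_all add: W_def h_def)
    have "A > 0" "B > 0" using pos by (simp_all only: A_def B_def)
    moreover have "W > 0" by (simp add: W_def add_nonneg_pos)
    ultimately have "1 / (2 * W) * (2 * h / A) + 45 * a\<^sup>2 / (2 * W) * (2 * h / B)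
        = h * ((B + 45 * a\<^sup>2 * A) / W) / (A * B)"
      by (simp add: field_simps)
    then show ?thesis unfolding h unfolding A_def B_def W_def h_def .
  qed
  also have "(v - 1 / (45 * a) + 45 * a\<^sup>2 * (v + a)) / (45 * a\<^sup>2 + 1) = v + s"
  proof -
    have "45 * a\<^sup>2 + 1 > 0" by (simp add: add_nonneg_pos)
    then show ?thesis using a by (simp add: s_def divide_simps) (simp add: algebra_simps power2_eq_square)
  qed
  also have "(v + a) * (v - 1 / (45 * a)) = v * (v + s) - 1/45"
    using a by (simp add: s_def field_simps)
  finally show ?thesis unfolding trigamma_approx_def v_def s_def .
qed

lemma F_has_derivative:
  assumes "a > 1/15" and x: "x > 0"
  shows "(F a has_real_derivative Polygamma 1 (x + 1) - trigamma_approx (a - 1 / (45 * a)) x) (at x)"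
proof -
  have "x + 1 \<notin> \<int>\<^sub>\<le>\<^sub>0" using x by (auto elim!: nonpos_Ints_cases)
  then show ?thesis
    unfolding F_def using L_approx_has_derivative[OF assms]
    by (auto intro!: derivative_eq_intros)
qed

lemma antimono_on_iff_deriv_nonpos:
  fixes f f' :: "real \<Rightarrow> real"
  assumes "\<And>x. x > a \<Longrightarrow> (f has_real_derivative f' x) (at x)"
  shows "antimono_on {a<..} f \<longleftrightarrow> (\<forall>x>a. f' x \<le> 0)"
proof
  assume anti: "antimono_on {a<..} f"
  show "\<forall>x>a. f' x \<le> 0"
  proof (intro allI impI, rule ccontr)
    fix x assume x: "x > a" and "\<not> f' x \<le> 0"
    then obtain d where "d > 0" "\<And>h. 0 < h \<Longrightarrow> h < d \<Longrightarrow> f x < f (x + h)"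
      using DERIV_pos_inc_right[OF assms[OF x]] by auto
    then have "f x < f (x + d / 2)" by simp
    moreover have "f (x + d / 2) \<le> f x"
      using monotone_onD[OF anti, of x "x + d / 2"] x \<open>d > 0\<close> by simp
    ultimately show False by simp
  qed
next
  assume *: "\<forall>x>a. f' x \<le> 0"
  show "antimono_on {a<..} f"
  proof (rule monotone_onI)
    fix x y assume xy: "x \<in> {a<..}" "y \<in> {a<..}" "x \<le> y"
    show "f y \<le> f x"
    proof (rule DERIV_nonpos_imp_nonincreasing[OF xy(3)])
      fix z assume "x \<le> z" "z \<le> y"
      then have "z > a" using xy by simp
      then show "\<exists>d. (f has_real_derivative d) (at z) \<and> d \<le> 0" using assms * by blast
    qed
  qed
qed

text \<open>The positive root of \<open>a\<^sup>2 - s_crit a - 1/45\<close>, that is of \<open>a - 1/(45 a) = s_crit\<close>.\<close>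

lemma a0'_eq: "a0' = (s_crit + sqrt (s_crit\<^sup>2 + 4/45)) / 2"
proof -
  define d where "d = 15 * (pi\<^sup>2 - 9)"
  have d: "d > 0" using pi_squared_bounds by (simp add: d_def)
  have s_crit: "s_crit = (45 - 4 * pi\<^sup>2) / d" by (simp add: s_crit_def d_def)
  have "s_crit\<^sup>2 + 4/45 = ((45 - 4 * pi\<^sup>2)\<^sup>2 + 4/45 * d\<^sup>2) / d\<^sup>2"
    using d by (simp add: s_crit field_simps)
  also have "(45 - 4 * pi\<^sup>2)\<^sup>2 + 4/45 * d\<^sup>2 = 3\<^sup>2 * (4 * pi ^ 4 - 80 * pi\<^sup>2 + 405)"
    by (simp add: d_def algebra_simps power2_eq_square power4_eq_xxxx)
  finally have "sqrt (s_crit\<^sup>2 + 4/45) = 3 * sqrt (4 * pi ^ 4 - 80 * pi\<^sup>2 + 405) / d"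
    using d by (simp only: real_sqrt_divide real_sqrt_mult real_sqrt_abs)
  then show ?thesis
    by (simp add: a0'_def s_crit d_def add_divide_distrib)
qed

lemma le_a0'_iff:
  assumes a: "a > 0"
  shows "a \<le> a0' \<longleftrightarrow> a - 1 / (45 * a) \<le> s_crit"
proof -
  have "s_crit < sqrt (s_crit\<^sup>2 + 4/45)" by (rule real_less_rsqrt) simp
  have "a \<le> a0' \<longleftrightarrow> 2 * a - s_crit \<le> sqrt (s_crit\<^sup>2 + 4/45)" by (auto simp: a0'_eq)
  also have "\<dots> \<longleftrightarrow> \<bar>2 * a - s_crit\<bar> \<le> sqrt (s_crit\<^sup>2 + 4/45)"
    using \<open>s_crit < sqrt (s_crit\<^sup>2 + 4/45)\<close> a by linarith
  also have "\<dots> \<longleftrightarrow> (2 * a - s_crit)\<^sup>2 \<le> s_crit\<^sup>2 + 4/45"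
    by (metis real_sqrt_abs real_sqrt_le_iff)
  also have "\<dots> \<longleftrightarrow> a - 1 / (45 * a) \<le> s_crit"
  proof -
    have "(2 * a - s_crit)\<^sup>2 - (s_crit\<^sup>2 + 4/45) = 4 * a * (a - 1 / (45 * a) - s_crit)"
      using a by (simp add: field_simps power2_eq_square)
    then have "(2 * a - s_crit)\<^sup>2 \<le> s_crit\<^sup>2 + 4/45 \<longleftrightarrow> 4 * a * (a - 1 / (45 * a) - s_crit) \<le> 0"
      by linarith
    also have "\<dots> \<longleftrightarrow> a - 1 / (45 * a) \<le> s_crit"
      using a by (simp add: mult_le_0_iff)
    finally show ?thesis .
  qed
  finally show ?thesis .
qed

theorem theorem2:
  fixes a :: real
  assumes "a \<in> {1/15<..}"
  shows "antimono_on {0<..} (F a) \<longleftrightarrow> a \<in> {1/15<..a0'}"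
proof -
  have a: "a > 1/15" using assms by simp
  have "1 / (45 * a) < 1/3" using a by (simp add: field_simps)
  then have s: "a - 1 / (45 * a) > - 4/15" using a by linarith
  have "antimono_on {0<..} (F a) \<longleftrightarrow> (\<forall>x>0. Polygamma 1 (x + 1) \<le> trigamma_approx (a - 1 / (45 * a)) x)"
    using antimono_on_iff_deriv_nonpos[OF F_has_derivative[OF a]] by simp
  also have "\<dots> \<longleftrightarrow> a - 1 / (45 * a) \<le> s_crit" by (rule trigamma_le_approx_iff[OF s])
  also have "\<dots> \<longleftrightarrow> a \<in> {1/15<..a0'}" using a le_a0'_iff[of a] by simp
  finally show ?thesis .
qed

end
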